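(* Let $0<q<1$, let $0\le n\le N$ be integers, and let $\alpha,\beta,\delta$ be nonzero complex numbers such that $\delta q^j\ne 1$ for all $j\in\mathbb{Z}$ and $\alpha q^j\neq 1$, $\beta\delta q^j\ne1$ for $1\le j\le N$. Then the $q$-Racah polynomials $r_n(x;\alpha,\beta,\delta,N;q)$ have the hypergeometric expression, for $x=0,1,\dots,N$, $$r_n(x;\alpha,\beta,\delta,N;q)={}_4\phi_3\left[\begin{array}{c}q^{-n},\delta q^{x-N},q^{-x},\alpha\beta q^{n+1}\\ \alpha q,\beta\delta q,q^{-N}\end{array};q,q\right].$$
   Context: Notation: $(a;q)_k=\prod_{i=0}^{k-1}(1-aq^i)$, $(a_1,\dots,a_r;q)_k=\prod_i (a_i;q)_k$, $\begin{bmatrix}n\\ k\end{bmatrix}_q=\frac{(q^{n-k+1};q)_k}{(q;q)_k}$ for $0\le k\le n$. The terminating series is ${}_4\phi_3\left[\begin{array}{c}q^{-n},a_2,a_3,a_4\\ b_1,b_2,b_3\end{array};q,z\right]=\sum_{k=0}^{n}\frac{(q^{-n},a_2,a_3,a_4;q)_k}{(q,b_1,b_2,b_3;q)_k}z^k$. For $0\le n\le N$ and $x=0,\dots,N$, $$r_n(x;\alpha,\beta,\delta,N;q)=\frac{(q;q)_n}{(q^{N-n+1};q)_n}\sum_{y=\max(x-N+n,0)}^{\min(x,n)}\begin{bmatrix}N-x\\ n-y\end{bmatrix}_q\begin{bmatrix}x\\ y\end{bmatrix}_q\frac{(\delta q^{x-N};q)_y(\delta q^{x-n+y+1};q)_{n-y}}{(\delta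 q^{y-n};q)_{n+1}}(1-\delta q^{2y-n})\,q^{y(y+N-x-n)}(\alpha\beta q^{n+1})^y\frac{(\alpha^{-1}\delta q^{-n},\beta^{-1}q^{-n};q)_y}{(\alpha q,\beta\delta q;q)_y}.$$ *)

theory Defs
  imports Complex_Main
begin

definition qpoch :: "'a::field \<Rightarrow> 'a \<Rightarrow> nat \<Rightarrow> 'a" where
  "qpoch a q k = (\<Prod>i<k. 1 - a * q ^ i)"

text \<open>Only used for \<open>k \<le> n\<close>.\<close>

definition qbinom :: "'a::field \<Rightarrow> nat \<Rightarrow> nat \<Rightarrow> 'a" where
  "qbinom q n k = qpoch (q powi (int n - int k + 1)) q k / qpoch q q k"

text \<open>The terminating series \<open>4\<phi>3[q\<^sup>-\<^sup>n, a2, a3, a4; b1, b2, b3; q, z]\<close>. The first upper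
  parameter is represented by \<open>n\<close>, and the sum stops at \<open>k = n\<close> even when another upper parameter
  terminates it earlier.\<close>

definition qphi43 ::
  "nat \<Rightarrow> 'a::field \<Rightarrow> 'a \<Rightarrow> 'a \<Rightarrow> 'a \<Rightarrow> 'a \<Rightarrow> 'a \<Rightarrow> 'a \<Rightarrow> 'a \<Rightarrow> 'a" where
  "qphi43 n a2 a3 a4 b1 b2 b3 q z =
    (\<Sum>k=0..n.
      (qpoch (q powi (- int n)) q k * qpoch a2 q k * qpoch a3 q k * qpoch a4 q k) /
      (qpoch q q k * qpoch b1 q k * qpoch b2 q k * qpoch b3 q k) * z ^ k)"

text \<open>The lower summation bound \<open>max (x - N + n) 0\<close> is the truncated difference \<open>x + n - N\<close>
  on natural numbers.\<close>

definition qRacah :: "nat \<Rightarrow> nat \<Rightarrow> 'a::field \<Rightarrow> 'a \<Rightarrow> 'a \<Rightarrow> nat \<Rightarrow> 'a \<Rightarrow> 'a" where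
  "qRacah n x \<alpha> \<beta> \<delta> N q =
    qpoch q q n / qpoch (q powi (int N - int n + 1)) q n *
    (\<Sum>y = x + n - N..min x n.
      qbinom q (N - x) (n - y) * qbinom q x y *
      (qpoch (\<delta> * q powi (int x - int N)) q y *
       qpoch (\<delta> * q powi (int x - int n + int y + 1)) q (n - y) /
       qpoch (\<delta> * q powi (int y - int n)) q (n + 1)) *
      (1 - \<delta> * q powi (2 * int y - int n)) *
      q powi (int y * (int y + int N - int x - int n)) *
      (\<alpha> * \<beta> * q ^ (n + 1)) ^ y *
      (qpoch (inverse \<alpha> * \<delta> * q powi (- int n)) q y * qpoch (inverse \<beta> * q powi (- int n)) q y /
       (qpoch (\<alpha> * q) q y * qpoch (\<beta> * \<delta> * q) q y)))"

end

theory Submission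
  imports Defs
begin

text \<open>
  The identity is a terminating case of Watson's transformation. In the summand, \<open>\<alpha>\<close> and \<open>\<beta>\<close>
  occur only in a factor that the q-Saalschuetz sum expands into terms
  \<open>(q\<^sup>-\<^sup>y, \<delta> q\<^sup>y\<^sup>-\<^sup>n; q)\<^sub>k\<close> with coefficients independent of \<open>y\<close>. After interchanging the
  two sums, the remaining factor times \<open>(q\<^sup>-\<^sup>y, \<delta> q\<^sup>y\<^sup>-\<^sup>n; q)\<^sub>k\<close> is, up to a constant, the same
  factor with \<open>n\<close>, \<open>N\<close>, \<open>x\<close>, \<open>y\<close> lowered by \<open>k\<close> and \<open>\<delta>\<close> replaced by \<open>\<delta> q\<^sup>k\<close>, so only
  the case \<open>k = 0\<close> has to be summed. This sum is a deformation by \<open>\<delta>\<close> of the q-Vandermonde sum;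
  it telescopes in differences with respect to \<open>x\<close>, and at \<open>x = 0\<close> it has a single term.
\<close>

section \<open>q-shifted factorials and q-binomial coefficients\<close>

lemma qpoch_0 [simp]: "qpoch a q 0 = 1"
  by (simp add: qpoch_def)

lemma qpoch_Suc: "qpoch a q (Suc k) = qpoch a q k * (1 - a * q ^ k)"
  by (simp add: qpoch_def)

lemma qpoch_Suc_left: "qpoch a q (Suc k) = (1 - a) * qpoch (a * q) q k"
  by (simp add: qpoch_def prod.lessThan_Suc_shift mult.assoc del: prod.lessThan_Suc)

lemma qpoch_eq_0_iff: "qpoch a q k = 0 \<longleftrightarrow> (\<exists>i<k. a * q ^ i = 1)"
  by (auto simp: qpoch_def)

context
  fixes q :: "'a::field"
  assumes q_nz: "q \<noteq> 0" and q_pow: "\<And>k. k > 0 \<Longrightarrow> q ^ k \<noteq> 1"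
begin

lemma qpoch_q_nz: "qpoch q q k \<noteq> 0"
  using q_pow[of "Suc _"] by (auto simp: qpoch_eq_0_iff)

lemma qbinom_0 [simp]: "qbinom q n 0 = 1"
  by (simp add: qbinom_def)

text \<open>The numerator contains the factor \<open>1 - q ^ 0\<close>. This allows sums over
  \<open>y\<close> to be extended beyond the range in which both q-binomials are nonzero.\<close>

lemma qbinom_eq_0: "n < k \<Longrightarrow> qbinom q n k = 0"
proof -
  assume "n < k"
  then have "q powi (int n - int k + 1) * q ^ (k - n - 1) = 1"
    using q_nz by (simp flip: power_int_of_nat power_int_add add: of_nat_diff)
  then have "qpoch (q powi (int n - int k + 1)) q k = 0"
    using \<open>n < k\<close> by (auto simp: qpoch_eq_0_iff intro!: exI[of _ "k - n - 1"])
  then show ?thesis by (simp add: qbinom_def)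
qed

lemma qbinom_nz: "k \<le> n \<Longrightarrow> qbinom q n k \<noteq> 0"
proof -
  assume k: "k \<le> n"
  have "q powi (int n - int k + 1) * q ^ i \<noteq> 1" for i
  proof -
    have "q powi (int n - int k + 1) * q ^ i = q ^ (n - k + 1 + i)"
      using q_nz k by (simp add: of_nat_diff algebra_simps flip: power_int_of_nat power_int_add)
    then show ?thesis using q_pow[of "n - k + 1 + i"] by simp
  qed
  then have "qpoch (q powi (int n - int k + 1)) q k \<noteq> 0" by (simp add: qpoch_eq_0_iff)
  then show ?thesis by (simp add: qbinom_def qpoch_q_nz)
qed

text \<open>Cross-multiplied and with an integer exponent, the ratio relation holds without a range
  condition: for \<open>n \<le> k\<close> both sides vanish.\<close>

lemma qbinom_Suc_right:
  "(1 - q ^ Suc k) * qbinom q n (Suc k) = (1 - q powi (int n - int k)) * qbinom q n k"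
proof -
  have "q powi (int n - int k) * q = q powi (int n - int k + 1)"
    using q_nz by (simp add: power_int_add)
  then have "qpoch (q powi (int n - int k)) q (Suc k) =
      (1 - q powi (int n - int k)) * qpoch (q powi (int n - int k + 1)) q k"
    by (simp only: qpoch_Suc_left)
  then show ?thesis
    using q_pow[of "Suc k"] by (simp add: qbinom_def qpoch_Suc[of q])
qed

lemma qbinom_Suc_Suc:
  "(1 - q ^ Suc k) * qbinom q (Suc n) (Suc k) = (1 - q ^ Suc n) * qbinom q n k"
proof -
  have "q powi (int n - int k + 1) * q ^ k = q ^ Suc n"
    using q_nz by (simp add: add.commute flip: power_int_of_nat power_int_add power_Suc)
  then have "qpoch (q powi (int n - int k + 1)) q (Suc k) =
      qpoch (q powi (int n - int k + 1)) q k * (1 - q ^ Suc n)"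
    by (simp only: qpoch_Suc)
  then show ?thesis
    using q_pow[of "Suc k"] by (simp add: qbinom_def qpoch_Suc[of q])
qed

section \<open>The q-Saalschuetz sum\<close>

text \<open>The letters \<open>b\<close> and \<open>c\<close> stand for the quotients
  \<open>C / A\<close> and \<open>B / A\<close>, and the third equation is the balancing condition.
  Multiplying \<open>a\<close>, \<open>A\<close>, \<open>B\<close>, \<open>C\<close> by
  \<open>q\<close> preserves all three equations, and the sums for \<open>y + 1\<close> and
  \<open>y\<close> differ by a multiple of the sum for \<open>y\<close> with these shifted
  parameters; hence the induction.\<close>

lemma q_Saalschuetz:
  assumes "A * b = C" "A * c = B" "A * b * c = a * q"
    and "qpoch B q y \<noteq> 0" "qpoch C q y \<noteq> 0"
  shows "(\<Sum>k\<le>y. qpoch (q powi (- int y)) q k * qpoch (a * q ^ y) q k * qpoch A q k /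
            (qpoch q q k * qpoch B q k * qpoch C q k) * q ^ k) =
         qpoch b q y * qpoch c q y * A ^ y / (qpoch B q y * qpoch C q y)"
  using assms
proof (induction y arbitrary: a A B C)
  case 0
  then show ?case by simp
next
  case (Suc y)
  define T where "T y a A B C k = qpoch (q powi (- int y)) q k * qpoch (a * q ^ y) q k * qpoch A q k /
            (qpoch q q k * qpoch B q k * qpoch C q k) * q ^ k" for y a A B C k
  define R where "R y A B C = qpoch b q y * qpoch c q y * A ^ y / (qpoch B q y * qpoch C q y)" for y A B C
  have B: "1 - B \<noteq> 0" "qpoch (B * q) q y \<noteq> 0" "qpoch B q y \<noteq> 0" "1 - B * q ^ y \<noteq> 0"
    and C: "1 - C \<noteq> 0" "qpoch (C * q) q y \<noteq> 0" "qpoch C q y \<noteq> 0" "1 - C * q ^ y \<noteq> 0"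
    using Suc.prems(4,5) qpoch_Suc[of B q y] qpoch_Suc[of C q y]
      qpoch_Suc_left[of B q y] qpoch_Suc_left[of C q y] by auto
  \<comment> \<open>The ratio in \<open>step\<close> between the termwise difference and the shifted
    term; it is independent of the summation index.\<close>
  define f where "f = - (q powi (- int y)) * (1 - a * q ^ (2 * y + 1)) * (1 - A) / ((1 - B) * (1 - C))"
  have "qpoch (q powi (- int y)) q (Suc y) = 0"
    using q_nz by (simp add: qpoch_Suc power_int_minus)
  then have T0: "T y a A B C (Suc y) = 0"
    by (simp add: T_def)
  have step: "T (Suc y) a A B C (Suc j) - T y a A B C (Suc j) = f * T y (a * q) (A * q) (B * q) (C * q) j"
    if "j \<le> y" for j
  proof -
    have Bj: "qpoch (B * q) q j \<noteq> 0" and Cj: "qpoch (C * q) q j \<noteq> 0"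
      using B(2) C(2) that unfolding qpoch_eq_0_iff by (meson order.strict_trans2)+
    define U where "U = q powi (- int y)"
    have U: "U * q ^ y = 1" using q_nz by (simp add: U_def power_int_minus)
    have U1: "q powi (- int (Suc y)) = U / q"
      using q_nz by (simp add: U_def power_int_minus power_int_diff field_simps)
    have e1: "qpoch (U / q) q (Suc j) = (1 - U / q) * qpoch U q j"
      using q_nz by (simp add: qpoch_Suc_left)
    have e2: "qpoch U q (Suc j) = qpoch U q j * (1 - U * q ^ j)" by (rule qpoch_Suc)
    have e3: "qpoch (a * q ^ Suc y) q (Suc j) = qpoch (a * q * q ^ y) q j * (1 - a * q * q ^ y * q ^ j)"
      by (simp add: qpoch_Suc ac_simps)
    have e4: "qpoch (a * q ^ y) q (Suc j) = (1 - a * q ^ y) * qpoch (a * q * q ^ y) q j"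
      by (simp add: qpoch_Suc_left ac_simps)
    have e5: "qpoch q q (Suc j) = qpoch q q j * (1 - q * q ^ j)" by (rule qpoch_Suc)
    have nz: "1 - q * q ^ j \<noteq> 0" using q_pow[of "Suc j"] by simp
    define V where "V = qpoch U q j * qpoch (a * q * q ^ y) q j * ((1 - A) * qpoch (A * q) q j)"
    define W where "W = qpoch q q j * ((1 - B) * qpoch (B * q) q j) * ((1 - C) * qpoch (C * q) q j)"
    have W: "W \<noteq> 0" using Bj Cj B C qpoch_q_nz[of j] by (simp add: W_def)
    \<comment> \<open>These are the factors in which the two terms still differ once the common ones
      are removed. The difference is divisible by \<open>1 - q * q ^ j\<close>, which cancels the
      last factor of \<open>qpoch q q (Suc j)\<close> and leaves a term of index
      \<open>j\<close>.\<close>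
    have key: "(1 - U / q) * (1 - a * q * q ^ y * q ^ j) - (1 - U * q ^ j) * (1 - a * q ^ y) =
       - (1 - q * q ^ j) * (U / q) * (1 - a * q * (q ^ y)\<^sup>2)"
    proof -
      define P Y J where "P = U / q" and "Y = q ^ y" and "J = q ^ j"
      have "U = P * q" "P * q * Y = 1" using q_nz U by (simp_all add: P_def Y_def)
      then show ?thesis unfolding P_def[symmetric] Y_def[symmetric] J_def[symmetric] by algebra
    qed
    have "T (Suc y) a A B C (Suc j) - T y a A B C (Suc j) =
        ((1 - U / q) * (1 - a * q * q ^ y * q ^ j) - (1 - U * q ^ j) * (1 - a * q ^ y)) *
        V / (W * (1 - q * q ^ j)) * q ^ Suc j"
      unfolding T_def U1 U_def[symmetric] e1 e2 e3 e4 e5 qpoch_Suc_left[of A] qpoch_Suc_left[of B] qpoch_Suc_left[of C]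
      unfolding V_def W_def using nz B C Bj Cj qpoch_q_nz[of j] by (simp add: divide_simps) (simp add: algebra_simps)
    also have "\<dots> = - U * (1 - a * q * (q ^ y)\<^sup>2) * V / W * q ^ j"
      unfolding key using nz W q_nz by (simp add: field_simps)
    also have "\<dots> = f * T y (a * q) (A * q) (B * q) (C * q) j"
      unfolding T_def f_def U_def[symmetric] V_def W_def
      by (simp add: power2_eq_square power_add mult_2 mult_2_right ac_simps)
    finally show ?thesis .
  qed
  have IH: "(\<Sum>k\<le>y. T y a A B C k) = R y A B C"
    using Suc.IH[OF Suc.prems(1-3) B(3) C(3)] by (simp add: T_def R_def)
  have IH': "(\<Sum>k\<le>y. T y (a * q) (A * q) (B * q) (C * q) k) = R y (A * q) (B * q) (C * q)"
    unfolding T_def R_def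
    by (rule Suc.IH) (use Suc.prems B C in \<open>auto simp: mult.assoc mult.left_commute mult.commute\<close>)
  have "(\<Sum>k\<le>Suc y. T (Suc y) a A B C k) - (\<Sum>k\<le>Suc y. T y a A B C k) =
      (\<Sum>k\<le>Suc y. T (Suc y) a A B C k - T y a A B C k)"
    by (simp only: sum_subtractf)
  \<comment> \<open>The two terms at \<open>k = 0\<close> are both 1 and cancel, so the index can be
    lowered by one.\<close>
  also have "\<dots> = (\<Sum>j\<le>y. f * T y (a * q) (A * q) (B * q) (C * q) j)"
    by (subst sum.atMost_Suc_shift) (simp add: step, simp add: T_def)
  also have "\<dots> = f * R y (A * q) (B * q) (C * q)"
    by (simp only: IH' flip: sum_distrib_left)
  finally have main: "(\<Sum>k\<le>Suc y. T (Suc y) a A B C k) = R y A B C + f * R y (A * q) (B * q) (C * q)"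
    using IH T0 by (simp add: diff_eq_eq add.commute)
  have "R y A B C + f * R y (A * q) (B * q) (C * q) = R (Suc y) A B C"
  proof -
    define Y where "Y = q ^ y"
    define U where "U = q powi (- int y)"
    have UY: "U * Y = 1" using q_nz by (simp add: U_def Y_def power_int_minus)
    define V where "V = qpoch b q y * qpoch c q y * A ^ y / (qpoch B q (Suc y) * qpoch C q (Suc y))"
    have r1: "R y A B C = V * ((1 - B * Y) * (1 - C * Y))"
      using B C by (simp add: R_def V_def qpoch_Suc Y_def)
    have r2: "f * R y (A * q) (B * q) (C * q) = - (U * Y) * (1 - a * q * Y\<^sup>2) * (1 - A) * V"
      using B C by (simp add: R_def V_def qpoch_Suc_left Y_def f_def U_def power_mult_distrib
        power2_eq_square power_add mult_2 mult_2_right ac_simps)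
    have r3: "R (Suc y) A B C = V * (A * (1 - b * Y) * (1 - c * Y))"
      by (simp add: R_def V_def Y_def qpoch_Suc[of b] qpoch_Suc[of c])
    \<comment> \<open>With \<open>B\<close>, \<open>C\<close> and \<open>a * q\<close> expressed by
      \<open>A\<close>, \<open>b\<close>, \<open>c\<close>, this is a polynomial identity in
      \<open>A\<close>, \<open>b\<close>, \<open>c\<close>, \<open>Y\<close>.\<close>
    have "(1 - B * Y) * (1 - C * Y) - (1 - a * q * Y\<^sup>2) * (1 - A) = A * (1 - b * Y) * (1 - c * Y)"
      unfolding Suc.prems(1,2)[symmetric] Suc.prems(3)[symmetric]
      by (simp add: algebra_simps power2_eq_square)
    then show ?thesis unfolding r1 r2 r3 UY by algebra
  qed
  with main show ?case by (simp add: T_def R_def)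
qed

section \<open>The kernel and its index shift\<close>

text \<open>The part of the summand of \<open>qRacah\<close> that depends on neither \<open>\<alpha>\<close> nor \<open>\<beta>\<close>.\<close>

definition racah_kernel :: "'a \<Rightarrow> nat \<Rightarrow> nat \<Rightarrow> nat \<Rightarrow> nat \<Rightarrow> 'a" where
  "racah_kernel \<delta> N n x y =
      qbinom q (N - x) (n - y) * qbinom q x y *
      (qpoch (\<delta> * q powi (int x - int N)) q y *
       qpoch (\<delta> * q powi (int x - int n + int y + 1)) q (n - y) /
       qpoch (\<delta> * q powi (int y - int n)) q (n + 1)) *
      (1 - \<delta> * q powi (2 * int y - int n)) *
      q powi (int y * (int y + int N - int x - int n))"

text \<open>The two extra factors on the left are the leading factors of \<open>(q\<^sup>-\<^sup>y,
  \<delta> q\<^sup>y\<^sup>-\<^sup>n; q)\<^sub>k\<close> at the raised indices. One lowers the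
  q-binomial in \<open>x\<close> and \<open>y\<close>, the other cancels the first factor of the
  denominator. The constant on the right is free of \<open>y\<close>, so it can leave the
  sum.\<close>

lemma racah_kernel_shift:
  assumes \<delta>: "\<And>j::int. \<delta> * q powi j \<noteq> 1" and "y \<le> n"
  shows "racah_kernel \<delta> (Suc N) (Suc n) (Suc x) (Suc y) *
      ((1 - q powi (- int (Suc y))) * (1 - \<delta> * q powi (int (Suc y) - int (Suc n)))) =
    - (q powi (int N - int x - int n - 1)) * (1 - q ^ Suc x) * (1 - \<delta> * q powi (int x - int N)) *
      racah_kernel (\<delta> * q) N n x y"
proof -
  have mq: "\<delta> * q powi i * q = \<delta> * q * q powi i" "\<delta> * q powi (i + 1) = \<delta> * q * q powi i" for i
    using q_nz by (simp_all add: power_int_add)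
  have e1: "qpoch (\<delta> * q powi (int x - int N)) q (Suc y) =
      (1 - \<delta> * q powi (int x - int N)) * qpoch (\<delta> * q * q powi (int x - int N)) q y"
    by (simp only: qpoch_Suc_left mq)
  have e2: "\<delta> * q powi (int (Suc x) - int (Suc n) + int (Suc y) + 1) =
      \<delta> * q * q powi (int x - int n + int y + 1)"
    using mq(2)[of "int x - int n + int y + 1"] by (simp add: algebra_simps)
  have e3: "qpoch (\<delta> * q powi (int y - int n)) q (Suc n + 1) =
      (1 - \<delta> * q powi (int y - int n)) * qpoch (\<delta> * q * q powi (int y - int n)) q (n + 1)"
    unfolding Suc_eq_plus1[symmetric] by (simp only: qpoch_Suc_left[of _ _ "Suc n"] mq)
  have e4: "\<delta> * q powi (2 * int (Suc y) - int (Suc n)) = \<delta> * q * q powi (2 * int y - int n)"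
    using mq(2)[of "2 * int y - int n"] by (simp add: algebra_simps)
  define Z where "Z = q powi (int y * (int y + int N - int x - int n))"
  have e5: "q powi (int (Suc y) * (int (Suc y) + int (Suc N) - int (Suc x) - int (Suc n))) =
      Z * q powi (int y + int N - int x - int n)"
    using q_nz by (simp add: Z_def algebra_simps flip: power_int_add)
  \<comment> \<open>Here the power of \<open>q\<close> split off in \<open>e5\<close> loses its
    dependence on \<open>y\<close>.\<close>
  have e6: "q powi (int y + int N - int x - int n) * (1 - q powi (- int (Suc y))) =
      - (q powi (int N - int x - int n - 1)) * (1 - q ^ Suc y)"
    using q_nz by (simp add: algebra_simps power_int_minus flip: power_Suc power_int_of_nat power_int_add)
  have b: "(1 - q ^ Suc y) * qbinom q (Suc x) (Suc y) = (1 - q ^ Suc x) * qbinom q x y"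
    by (rule qbinom_Suc_Suc)
  have nz: "1 - \<delta> * q powi (int y - int n) \<noteq> 0"
    using \<delta>[of "int y - int n"] by simp
  define c1 where "c1 = qbinom q (N - x) (n - y)"
  define c2 where "c2 = (qpoch (\<delta> * q * q powi (int x - int N)) q y *
       qpoch (\<delta> * q * q powi (int x - int n + int y + 1)) q (n - y) /
       qpoch (\<delta> * q * q powi (int y - int n)) q (n + 1)) * (1 - \<delta> * q * q powi (2 * int y - int n))"
  define v where "v = 1 - \<delta> * q powi (int x - int N)"
  have l: "racah_kernel \<delta> (Suc N) (Suc n) (Suc x) (Suc y) *
      ((1 - q powi (- int (Suc y))) * (1 - \<delta> * q powi (int (Suc y) - int (Suc n)))) =
      c1 * qbinom q (Suc x) (Suc y) * v * c2 * Z *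
      (q powi (int y + int N - int x - int n) * (1 - q powi (- int (Suc y))))"
    unfolding racah_kernel_def e2 e4 e5
    using nz by (simp add: e1 e3[simplified] c1_def c2_def v_def ac_simps)
  have r: "racah_kernel (\<delta> * q) N n x y = c1 * qbinom q x y * c2 * Z"
    by (simp add: racah_kernel_def c1_def c2_def Z_def ac_simps)
  have collect: "c1 * B * v * c2 * Z * (- P * s) = - P * t * v * (c1 * B' * c2 * Z)"
    if "s * B = t * B'" for s t B B' P
    using that by algebra
  show ?thesis
    unfolding l r e6 v_def[symmetric] by (rule collect[OF b])
qed

text \<open>Outside the summation range of \<open>qRacah\<close> one of the two q-binomials
  vanishes, so the sum may run over all \<open>y \<le> n\<close>.\<close>

lemma racah_kernel_eq_0:
  assumes "y < x + n - N \<or> x < y" "x \<le> N"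
  shows "racah_kernel \<delta> N n x y = 0"
proof -
  have "N - x < n - y \<or> x < y" using assms by linarith
  then show ?thesis
    using qbinom_eq_0[of "N - x" "n - y"] qbinom_eq_0[of x y] by (auto simp: racah_kernel_def)
qed

section \<open>Telescoping in \<open>x\<close>\<close>

text \<open>A Wilf--Zeilberger certificate for the independence of \<open>x\<close> of the sum of the kernel.\<close>

definition racah_certificate :: "'a \<Rightarrow> nat \<Rightarrow> nat \<Rightarrow> nat \<Rightarrow> nat \<Rightarrow> 'a" where
  "racah_certificate \<delta> N n x y = (if y = 0 \<or> n < y then 0 else
      - (1 - \<delta> * q powi (2 * int x + 1 - int N)) *
      (qbinom q (N - x - 1) (n - y) * qbinom q x (y - 1)) *
      (qpoch (\<delta> * q powi (int x - int N + 1)) q (y - 1) *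
       qpoch (\<delta> * q powi (int x - int n + int y + 1)) q (n - y) /
       qpoch (\<delta> * q powi (int y - int n)) q n) *
      q powi (int y * (int y + int N - int x - int n - 1)))"

text \<open>This is the Wilf-Zeilberger equation with the common factors removed and powers of
  \<open>q\<close> replaced by letters. The pairs \<open>p1\<close>, \<open>p3\<close> and
  \<open>r1\<close>, \<open>r3\<close> stand for neighbouring q-binomials, of which only the ratio
  relations \<open>p\<close> and \<open>r\<close> are used.\<close>

lemma certificate_identity:
  fixes p1 p3 r1 r3 v L K X Y :: 'a
  assumes p: "p3 * (1 - L) = p1 * (1 - K)" and r: "r3 * (Y - X * q) = r1 * (1 - Y) * Y"
  shows "p1 * (r3 + Y * r1) * (1 - v * Y) * (1 - v * L * X * q * K) * (1 - v * L * Y)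
      - (p3 + K * p1) * r1 * (1 - v) * (1 - v * L * X * q) * (1 - v * L * Y) * Y =
      (1 - v * X * q) * (p1 * r3) * (1 - v * L * X * q) * (1 - v * L * Y * K)
      - (1 - v * X * q) * (p3 * r1) * (1 - v * Y) * (1 - v * L) * Y * L" (is "?l1 - ?l2 = ?r1 - ?r2")
proof -
  define W where "W = X * q"
  \<comment> \<open>\<open>\<mu>\<close> and \<open>\<nu>\<close> are the cofactors that write the
    difference of the two sides as a combination of the relations \<open>r\<close> and
    \<open>p\<close>.\<close>
  define \<mu> where "\<mu> = v * v * L * (Y + W) - v - v * L + v * L * K * (1 - v * v * L * W * Y)"
  define \<nu> where "\<nu> = - Y * (1 - v * (L + 1) + v * v * L * (W + Y) - v * v * L * W * Y)"
  have "?l1 - ?l2 - (?r1 - ?r2) =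
      \<mu> * p1 * (r3 * (Y - W) - r1 * (1 - Y) * Y) + \<nu> * r1 * (p3 * (1 - L) - p1 * (1 - K))"
    unfolding mult.assoc W_def[symmetric] \<mu>_def \<nu>_def by (simp add: algebra_simps W_def)
  also have "\<dots> = 0" using p r by (simp add: W_def)
  finally show ?thesis by simp
qed

text \<open>All four terms share the factor \<open>s * t * Z / den\<close>; expanding the raised
  q-binomials by the q-Pascal rule leaves \<open>certificate_identity\<close>.\<close>

lemma racah_kernel_step:
  assumes \<delta>: "\<And>j::int. \<delta> * q powi j \<noteq> 1" and "y \<le> n" "x < N"
  shows "racah_kernel \<delta> N n (Suc x) y - racah_kernel \<delta> N n x y =
    racah_certificate \<delta> N n x (Suc y) - racah_certificate \<delta> N n x y"
proof -
  define G where "G = racah_certificate \<delta> N n x"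
  note G_def = G_def racah_certificate_def
  \<comment> \<open>With \<open>M\<close> and \<open>m\<close> the truncated differences
    \<open>N - x - 1\<close> and \<open>n - y\<close> become plain variables.\<close>
  obtain M where N: "N = x + 1 + M" using \<open>x < N\<close> by (auto simp: less_iff_Suc_add)
  obtain m where n: "n = y + m" using \<open>y \<le> n\<close> by (auto simp: le_iff_add)
  define X Y K L E v Z where "X = q ^ x" and "Y = q ^ y" and "K = q ^ m"
    and "L = q powi (int M + 1 - int m)" and "E = \<delta> * q powi (- int m)"
    and "v = \<delta> * q powi (- 1 - int M)"
    and "Z = q powi (int y * (int y + int M - int y - int m))"
  note defs = X_def Y_def K_def L_def E_def v_def Z_def
  have pw: "q powi i * q ^ j = q powi (i + int j)" "q powi i * q = q powi (i + 1)" for i j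
    using q_nz by (simp_all add: power_int_add)
  have EvL: "E = v * L"
    using q_nz by (simp add: defs mult.assoc flip: power_int_add)
  have a1: "\<delta> * q powi (int (Suc x) - int N) = v * q" "\<delta> * q powi (int x - int N) = v"
      "\<delta> * q powi (int x - int N + 1) = v * q"
    by (simp_all add: N defs pw mult.assoc)
  have a2: "\<delta> * q powi (int (Suc x) - int n + int y + 1) = E * X * q * q"
      "\<delta> * q powi (int x - int n + int y + 1) = E * X * q"
      "\<delta> * q powi (int x - int n + int (Suc y) + 1) = E * X * q * q"
    using q_nz by (simp_all add: n defs power_int_add power_int_diff power_int_minus power2_eq_square field_simps)
  have a3: "\<delta> * q powi (int y - int n) = E" "\<delta> * q powi (int (Suc y) - int n) = E * q"
      "\<delta> * q powi (2 * int y - int n) = E * Y"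
    using q_nz by (simp_all add: n defs power_int_add power_int_diff power_int_minus power2_eq_square field_simps)
  have a4: "\<delta> * q powi (2 * int x + 1 - int N) = v * X * q"
    using q_nz by (simp add: N defs power_int_add power_int_diff power_int_minus power2_eq_square field_simps)
  have z: "q powi (int y * (int y + int N - int (Suc x) - int n)) = Z"
      "q powi (int y * (int y + int N - int x - int n)) = Z * Y"
      "q powi (int y * (int y + int N - int x - int n - 1)) = Z"
      "q powi (int (Suc y) * (int (Suc y) + int N - int x - int n - 1)) = Z * Y * L"
    using q_nz by (simp_all add: N n defs algebra_simps flip: power_int_of_nat power_int_add)
  have d: "N - Suc x = M" "N - x = Suc M" "n - y = m" "N - x - 1 = M"
    by (simp_all add: N n)
  have nz: "1 - v \<noteq> 0" "1 - E \<noteq> 0" "1 - E * Y * K \<noteq> 0" "1 - E * X * q * K \<noteq> 0"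
    using \<delta>[of "- 1 - int M"] \<delta>[of "- int m"] \<delta>[of "int y"] \<delta>[of "int x + 1"] q_nz
    by (simp_all add: defs mult.assoc flip: power_int_of_nat power_int_add power_int_add_1 power_int_add_1')
  define den where "den = qpoch E q (n + 1)"
  have den: "den = qpoch E q n * (1 - E * Y * K)" "den = (1 - E) * qpoch (E * q) q n"
    unfolding den_def Suc_eq_plus1[symmetric]
    by (simp add: qpoch_Suc n defs power_add mult.assoc, simp only: qpoch_Suc_left)
  \<comment> \<open>The denominators of the two certificate terms lack the last and the first factor
    of \<open>den\<close>, respectively.\<close>
  have dens: "1 / qpoch E q n = (1 - E * Y * K) / den" "1 / qpoch (E * q) q n = (1 - E) / den"
    using nz by (simp add: den(1), simp add: den(2))
  (* The values at m = 0 and y = 0 are chosen so that the recurrences below hold at the ends of the range. *)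
  define p3 where "p3 = (if m = 0 then 0 else qbinom q M (m - 1))"
  define r3 where "r3 = (if y = 0 then 0 else qbinom q x (y - 1))"
  define s where "s = (if y = 0 then 1 / (1 - v) else qpoch (v * q) q (y - 1))"
  define t where "t = (if m = 0 then 1 / (1 - E * X * q * K) else qpoch (E * X * q * q) q (m - 1))"
  define p1 r1 where "p1 = qbinom q M m" and "r1 = qbinom q x y"
  have L: "L * K = q ^ Suc M"
    using q_nz by (simp add: defs add.commute flip: power_int_of_nat power_int_add power_Suc)
  \<comment> \<open>The ratio relation comes first; the q-Pascal rule then follows by cancelling
    \<open>1 - K\<close>, which is nonzero for \<open>m > 0\<close>. The same pattern gives
    \<open>r\<close>.\<close>
  have p: "p3 * (1 - L) = p1 * (1 - K)" "qbinom q (Suc M) m = p3 + K * p1"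
  proof -
    show 1: "p3 * (1 - L) = p1 * (1 - K)"
    proof (cases m)
      case (Suc m')
      then show ?thesis using qbinom_Suc_right[of m' M] by (simp add: p3_def p1_def defs algebra_simps)
    qed (simp add: p3_def defs)
    show "qbinom q (Suc M) m = p3 + K * p1"
    proof (cases m)
      case (Suc m')
      have "(1 - K) * qbinom q (Suc M) m = (1 - K * L) * p3"
        unfolding mult.commute[of K L] L
        using qbinom_Suc_Suc[of m' M] by (simp add: Suc p3_def K_def del: power_Suc)
      also have "\<dots> = (1 - K) * (p3 + K * p1)"
        using 1 by algebra
      finally show ?thesis using q_pow[of m] Suc by (simp add: K_def)
    qed (simp add: p3_def p1_def defs)
  qed
  have r: "r3 * (Y - X * q) = r1 * (1 - Y) * Y" "qbinom q (Suc x) y = r3 + Y * r1"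
  proof -
    show 1: "r3 * (Y - X * q) = r1 * (1 - Y) * Y"
    proof (cases y)
      case (Suc y')
      have "q powi (int x - int y') * Y = X * q"
        using q_nz by (simp add: Suc defs add.commute flip: power_int_of_nat power_int_add power_Suc power_Suc2 power_int_add_1 power_int_add_1')
      moreover have "(1 - Y) * r1 = (1 - q powi (int x - int y')) * r3"
        using qbinom_Suc_right[of y' x] by (simp add: Suc r3_def r1_def Y_def)
      ultimately show ?thesis by algebra
    qed (simp add: r3_def defs)
    show "qbinom q (Suc x) y = r3 + Y * r1"
    proof (cases y)
      case (Suc y')
      have "(1 - Y) * qbinom q (Suc x) y = (1 - X * q) * r3"
        using qbinom_Suc_Suc[of y' x] by (simp add: Suc r3_def defs mult.commute)
      also have "\<dots> = (1 - Y) * (r3 + Y * r1)"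
        using 1 by algebra
      finally show ?thesis using q_pow[of y] Suc by (simp add: Y_def)
    qed (simp add: r3_def r1_def defs)
  qed
  have s: "qpoch (v * q) q y = s * (1 - v * Y)" "qpoch v q y = (1 - v) * s"
  proof -
    show "qpoch (v * q) q y = s * (1 - v * Y)"
      using nz(1) by (cases y) (simp_all add: s_def Y_def qpoch_Suc mult.assoc)
    show "qpoch v q y = (1 - v) * s"
      using nz(1) by (cases y) (simp_all add: s_def qpoch_Suc_left[of v])
  qed
  have t: "qpoch (E * X * q * q) q m = t * (1 - E * X * q * K)"
      "qpoch (E * X * q) q m = (1 - E * X * q) * t"
  proof -
    show "qpoch (E * X * q * q) q m = t * (1 - E * X * q * K)"
      using nz(4) by (cases m) (simp_all add: t_def K_def qpoch_Suc mult.assoc)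
    show "qpoch (E * X * q) q m = (1 - E * X * q) * t"
      using nz(4) by (cases m) (simp_all add: t_def K_def qpoch_Suc_left[of "E * X * q"])
  qed
  \<comment> \<open>The cutoffs of the certificate at \<open>y = 0\<close> and beyond
    \<open>n\<close> match the defaults \<open>r3 = 0\<close> and \<open>p3 = 0\<close>, so
    \<open>Gy\<close> and \<open>GS\<close> hold at the ends too.\<close>
  have Gy: "G y = - (1 - v * X * q) * (p1 * r3) * (s * ((1 - E * X * q) * t)) * (1 - E * Y * K) * Z / den"
  proof (cases "y = 0")
    case False
    have "G y = - (1 - v * X * q) * (p1 * r3) * (s * ((1 - E * X * q) * t)) * Z * (1 / qpoch E q n)"
      using False \<open>y \<le> n\<close> unfolding G_def a1 a2 a3 a4 z d t(2)
      by (simp add: r3_def p1_def s_def)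
    then show ?thesis by (simp add: dens)
  qed (simp add: G_def r3_def)
  have GS: "G (Suc y) = - (1 - v * X * q) * (p3 * r1) * (s * (1 - v * Y) * t) * (1 - E) * Z * Y * L / den"
  proof (cases "m = 0")
    case False
    have dm: "n - Suc y = m - 1" by (simp add: n)
    have "G (Suc y) = - (1 - v * X * q) * (p3 * r1) * (s * (1 - v * Y) * t) * (Z * Y * L) * (1 / qpoch (E * q) q n)"
      using False unfolding G_def a1 a2 a3 a4 z d dm
      by (simp add: n p3_def r1_def t_def s)
    then show ?thesis by (simp add: dens)
  qed (simp add: G_def p3_def n)
  have w1: "racah_kernel \<delta> N n (Suc x) y =
      p1 * (r3 + Y * r1) * (s * (1 - v * Y)) * (t * (1 - E * X * q * K)) * (1 - E * Y) * Z / den"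
    unfolding racah_kernel_def a1 a2 a3 z d r(2) s t den_def[symmetric] p1_def[symmetric] by simp
  have w0: "racah_kernel \<delta> N n x y =
      (p3 + K * p1) * r1 * ((1 - v) * s) * ((1 - E * X * q) * t) * (1 - E * Y) * Z * Y / den"
    unfolding racah_kernel_def a1 a2 a3 z d p(2) s t den_def[symmetric] r1_def[symmetric] by simp
  have key: "p1 * (r3 + Y * r1) * (1 - v * Y) * (1 - E * X * q * K) * (1 - E * Y)
      - (p3 + K * p1) * r1 * (1 - v) * (1 - E * X * q) * (1 - E * Y) * Y =
      (1 - v * X * q) * (p1 * r3) * (1 - E * X * q) * (1 - E * Y * K)
      - (1 - v * X * q) * (p3 * r1) * (1 - v * Y) * (1 - E) * Y * L"
    unfolding EvL by (rule certificate_identity[OF p(1) r(1)])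
  have "racah_kernel \<delta> N n (Suc x) y - racah_kernel \<delta> N n x y =
      (p1 * (r3 + Y * r1) * (1 - v * Y) * (1 - E * X * q * K) * (1 - E * Y)
      - (p3 + K * p1) * r1 * (1 - v) * (1 - E * X * q) * (1 - E * Y) * Y) * (s * t * Z / den)"
    unfolding w1 w0 diff_divide_distrib[symmetric] times_divide_eq_right
    by (rule arg_cong[of _ _ "\<lambda>u. u / den"]) algebra
  also have "\<dots> = G (Suc y) - G y"
    unfolding key Gy GS diff_divide_distrib[symmetric] times_divide_eq_right
    by (rule arg_cong[of _ _ "\<lambda>u. u / den"]) algebra
  finally show ?thesis by (simp add: G_def(1))
qed

text \<open>For \<open>\<delta> = 0\<close> this is the q-Vandermonde sum. The value does not depend
  on \<open>x\<close>, because differences in \<open>x\<close> telescope, so it can be read off at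
  \<open>x = 0\<close>.\<close>

lemma sum_racah_kernel:
  assumes \<delta>: "\<And>j::int. \<delta> * q powi j \<noteq> 1" and "x \<le> N"
  shows "(\<Sum>y\<le>n. racah_kernel \<delta> N n x y) = qbinom q N n"
  using \<open>x \<le> N\<close>
proof (induction x)
  case 0
  have "racah_kernel \<delta> N n 0 y = 0" if "y \<noteq> 0" for y
    using that by (simp add: racah_kernel_eq_0)
  then have "(\<Sum>y\<le>n. racah_kernel \<delta> N n 0 y) = racah_kernel \<delta> N n 0 0"
    by (subst sum.mono_neutral_right[of _ "{0}"]) auto
  also have "\<dots> = qbinom q N n"
  proof -
    have "\<delta> * q powi (- int n + 1) = \<delta> * q powi (- int n) * q"
      using power_int_add_1[of q "- int n"] q_nz by (simp only: mult.assoc simp_thms)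
    then have "qpoch (\<delta> * q powi (- int n)) q (n + 1) =
        (1 - \<delta> * q powi (- int n)) * qpoch (\<delta> * q powi (- int n + 1)) q n"
      unfolding Suc_eq_plus1[symmetric] by (simp only: qpoch_Suc_left)
    moreover have "qpoch (\<delta> * q powi (- int n + 1)) q n \<noteq> 0"
    proof -
      have "\<delta> * q powi (- int n + 1) * q ^ i \<noteq> 1" for i
        using \<delta>[of "- int n + 1 + int i"] q_nz by (simp add: power_int_add mult.assoc)
      then show ?thesis by (simp add: qpoch_eq_0_iff)
    qed
    ultimately show ?thesis
      using \<delta>[of "- int n"] by (simp add: racah_kernel_def)
  qed
  finally show ?case .
next
  case (Suc x)
  have "(\<Sum>y\<le>n. racah_kernel \<delta> N n (Suc x) y) - (\<Sum>y\<le>n. racah_kernel \<delta> N n x y) =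
      (\<Sum>y<Suc n. racah_certificate \<delta> N n x (Suc y) - racah_certificate \<delta> N n x y)"
    unfolding sum_subtractf[symmetric]
    by (rule sum.cong) (use racah_kernel_step[OF \<delta>] Suc.prems in auto)
  \<comment> \<open>The telescoped sum is zero because the certificate vanishes at
    \<open>y = 0\<close> and at \<open>y = n + 1\<close>.\<close>
  then show ?case
    using Suc by (simp only: sum_lessThan_telescope) (simp add: racah_certificate_def)
qed

section \<open>Kernel sums weighted by q-shifted factorials\<close>

text \<open>Each induction step strips the leading factors by \<open>racah_kernel_shift\<close>,
  which lowers \<open>n\<close>, \<open>N\<close>, \<open>x\<close> and replaces
  \<open>\<delta>\<close> by \<open>\<delta> * q\<close>; after \<open>k\<close> steps
  \<open>sum_racah_kernel\<close> applies.\<close>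

lemma sum_racah_kernel_qpoch:
  assumes "\<And>j::int. \<delta> * q powi j \<noteq> 1" and "x \<le> N" "n \<le> N" "k \<le> n"
  shows "(\<Sum>y\<le>n. racah_kernel \<delta> N n x y *
      (qpoch (q powi (- int y)) q k * qpoch (\<delta> * q powi (int y - int n)) q k)) =
    qpoch (q powi (- int n)) q k * qpoch (\<delta> * q powi (int x - int N)) q k *
      qpoch (q powi (- int x)) q k / qpoch (q powi (- int N)) q k * qbinom q N n"
  using assms
proof (induction k arbitrary: N n x \<delta>)
  case 0
  then show ?case by (simp add: sum_racah_kernel)
next
  case (Suc k)
  note \<delta> = Suc.prems(1)
  obtain n' N' where n: "n = Suc n'" and N: "N = Suc N'"
    using Suc.prems by (metis Suc_le_D)
  have left: "qpoch (q powi (- int (Suc i))) q (Suc k) = (1 - q powi (- int (Suc i))) * qpoch (q powi (- int i)) q k" for i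
  proof -
    have "q powi (- int (Suc i)) * q = q powi (- int i)"
      using power_int_add_1[of q "- int (Suc i)"] q_nz by simp
    then show ?thesis by (simp only: qpoch_Suc_left)
  qed
  have zero: "qpoch (q powi (- int 0)) q (Suc k) = 0"
    by (simp add: qpoch_Suc_left)
  show ?case
  proof (cases x)
    case 0
    \<comment> \<open>For \<open>x = 0\<close> both sides vanish: the kernel kills
      \<open>y > 0\<close>, and \<open>zero\<close> kills \<open>y = 0\<close> as well as the
      right-hand side.\<close>
    have "racah_kernel \<delta> N n 0 y * (qpoch (q powi (- int y)) q (Suc k) *
        qpoch (\<delta> * q powi (int y - int n)) q (Suc k)) = 0" for y
      using zero by (cases y) (auto simp: racah_kernel_eq_0)
    then have "(\<Sum>y\<le>n. racah_kernel \<delta> N n 0 y * (qpoch (q powi (- int y)) q (Suc k) *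
        qpoch (\<delta> * q powi (int y - int n)) q (Suc k))) = 0"
      by (intro sum.neutral) blast
    then show ?thesis
      unfolding 0 zero by simp
  next
    case x: (Suc x')
    define c where "c = - (q powi (int N' - int x' - int n' - 1)) * (1 - q ^ x) *
      (1 - \<delta> * q powi (int x' - int N'))"
    have \<delta>q: "\<delta> * q * q powi i = \<delta> * q powi (i + 1)" for i
      using q_nz by (simp add: power_int_add)
    have term_eq: "racah_kernel \<delta> N n x (Suc y) * (qpoch (q powi (- int (Suc y))) q (Suc k) *
        qpoch (\<delta> * q powi (int (Suc y) - int n)) q (Suc k)) =
      c * (racah_kernel (\<delta> * q) N' n' x' y * (qpoch (q powi (- int y)) q k *
        qpoch (\<delta> * q * q powi (int y - int n')) q k))"
      if "y \<le> n'" for y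
    proof -
      have "\<delta> * q powi (int (Suc y) - int n) * q = \<delta> * q * q powi (int y - int n')"
        by (simp add: n ac_simps)
      then have "qpoch (\<delta> * q powi (int (Suc y) - int n)) q (Suc k) =
          (1 - \<delta> * q powi (int (Suc y) - int n)) * qpoch (\<delta> * q * q powi (int y - int n')) q k"
        by (simp only: qpoch_Suc_left)
      then have "racah_kernel \<delta> N n x (Suc y) * (qpoch (q powi (- int (Suc y))) q (Suc k) *
          qpoch (\<delta> * q powi (int (Suc y) - int n)) q (Suc k)) =
        racah_kernel \<delta> N n x (Suc y) *
          ((1 - q powi (- int (Suc y))) * (1 - \<delta> * q powi (int (Suc y) - int n))) *
        (qpoch (q powi (- int y)) q k * qpoch (\<delta> * q * q powi (int y - int n')) q k)"
        by (simp only: left ac_simps)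
      then show ?thesis
        unfolding N n x c_def racah_kernel_shift[OF \<delta> that] by (simp only: ac_simps)
    qed
    have IH: "(\<Sum>y\<le>n'. racah_kernel (\<delta> * q) N' n' x' y *
        (qpoch (q powi (- int y)) q k * qpoch (\<delta> * q * q powi (int y - int n')) q k)) =
      qpoch (q powi (- int n')) q k * qpoch (\<delta> * q * q powi (int x' - int N')) q k *
        qpoch (q powi (- int x')) q k / qpoch (q powi (- int N')) q k * qbinom q N' n'"
      by (rule Suc.IH) (use Suc.prems in \<open>auto simp: N n x \<delta>q simp del: power_int_add_1 power_int_add_1'\<close>)
    have "(\<Sum>y\<le>n. racah_kernel \<delta> N n x y *
        (qpoch (q powi (- int y)) q (Suc k) * qpoch (\<delta> * q powi (int y - int n)) q (Suc k))) =
      (\<Sum>y\<le>n'. racah_kernel \<delta> N n x (Suc y) *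
        (qpoch (q powi (- int (Suc y))) q (Suc k) * qpoch (\<delta> * q powi (int (Suc y) - int n)) q (Suc k)))"
      unfolding n sum.atMost_Suc_shift zero by simp
    also have "\<dots> = c * (\<Sum>y\<le>n'. racah_kernel (\<delta> * q) N' n' x' y *
        (qpoch (q powi (- int y)) q k * qpoch (\<delta> * q * q powi (int y - int n')) q k))"
      unfolding sum_distrib_left by (rule sum.cong) (simp_all only: term_eq atMost_iff)
    also have "\<dots> = qpoch (q powi (- int n)) q (Suc k) * qpoch (\<delta> * q powi (int x - int N)) q (Suc k) *
        qpoch (q powi (- int x)) q (Suc k) / qpoch (q powi (- int N)) q (Suc k) * qbinom q N n"
    proof -
      have d: "qpoch (\<delta> * q powi (int x - int N)) q (Suc k) =
          (1 - \<delta> * q powi (int x' - int N')) * qpoch (\<delta> * q * q powi (int x' - int N')) q k"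
        by (simp add: N x qpoch_Suc_left ac_simps)
      have b: "qbinom q N n = (1 - q ^ N) / (1 - q ^ n) * qbinom q N' n'"
        using qbinom_Suc_Suc[of n' N'] q_pow[of n] by (simp add: N n divide_simps mult.commute)
      have l: "qpoch (q powi (- int n)) q (Suc k) = (1 - q powi (- int n)) * qpoch (q powi (- int n')) q k"
          "qpoch (q powi (- int x)) q (Suc k) = (1 - q powi (- int x)) * qpoch (q powi (- int x')) q k"
          "qpoch (q powi (- int N)) q (Suc k) = (1 - q powi (- int N)) * qpoch (q powi (- int N')) q k"
        by (simp_all only: n x N left)
      have flip: "1 - q powi (- int i) = - (1 - q ^ i) / q ^ i" for i
        using q_nz by (simp add: power_int_minus field_simps)
      have nN: "1 - q ^ N \<noteq> 0" "1 - q ^ n \<noteq> 0"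
        using q_pow[of n] q_pow[of N] by (auto simp: N n)
      \<comment> \<open>The shift constant is exactly the quotient of the leading factors peeled off
        in \<open>d\<close> and \<open>l\<close>, times the ratio of the q-binomials in
        \<open>b\<close>.\<close>
      have c: "c = (1 - q powi (- int n)) * (1 - q powi (- int x)) * (1 - \<delta> * q powi (int x' - int N')) /
          (1 - q powi (- int N)) * ((1 - q ^ N) / (1 - q ^ n))"
      proof -
        have e: "q powi (int N' - int x' - int n' - 1) = q ^ N / (q ^ x * q ^ n)"
          using q_nz by (simp add: N n x power_int_add power_int_diff field_simps)
        show ?thesis
          unfolding c_def flip e using nN q_nz by (simp add: divide_simps) (simp add: algebra_simps)
      qed
      show ?thesis
        unfolding IH d b c l by (simp add: ac_simps)
    qed
    finally show ?thesis .
  qed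
qed

section \<open>Expansion and interchange of the sums\<close>

text \<open>The argument is purely algebraic, so it is carried out over any field in which
  \<open>q\<close> is nonzero and not a root of unity.\<close>

lemma qRacah_eq_qphi43:
  assumes \<delta>: "\<And>j::int. \<delta> * q powi j \<noteq> 1" and "\<alpha> \<noteq> 0" "\<beta> \<noteq> 0"
    and \<alpha>: "\<And>j. 1 \<le> j \<Longrightarrow> j \<le> n \<Longrightarrow> \<alpha> * q ^ j \<noteq> 1"
    and \<beta>: "\<And>j. 1 \<le> j \<Longrightarrow> j \<le> n \<Longrightarrow> \<beta> * \<delta> * q ^ j \<noteq> 1"
    and "n \<le> N" "x \<le> N"
  shows "qRacah n x \<alpha> \<beta> \<delta> N q =
    qphi43 n (\<delta> * q powi (int x - int N)) (q powi (- int x)) (\<alpha> * \<beta> * q ^ (n + 1))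
      (\<alpha> * q) (\<beta> * \<delta> * q) (q powi (- int N)) q q"
proof -
  define A where "A = \<alpha> * \<beta> * q ^ (n + 1)"
  \<comment> \<open>In the q-Saalschuetz sum these give \<open>A * c = \<alpha> * q\<close> and
    \<open>A * b = \<beta> * \<delta> * q\<close> as lower parameters, with
    \<open>a = \<delta> * q powi (- int n)\<close>.\<close>
  define b c where "b = inverse \<alpha> * \<delta> * q powi (- int n)" and "c = inverse \<beta> * q powi (- int n)"
  define S where "S y k = qpoch (q powi (- int y)) q k * qpoch (\<delta> * q powi (int y - int n)) q k" for y k
  define d where "d k = qpoch A q k / (qpoch q q k * qpoch (\<alpha> * q) q k * qpoch (\<beta> * \<delta> * q) q k) * q ^ k" for k
  have expand: "A ^ y * (qpoch b q y * qpoch c q y / (qpoch (\<alpha> * q) q y * qpoch (\<beta> * \<delta> * q) q y)) =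
      (\<Sum>k\<le>n. S y k * d k)" if "y \<le> n" for y
  proof -
    have e: "\<delta> * q powi (- int n) * q ^ y = \<delta> * q powi (int y - int n)"
      using q_nz by (simp add: power_int_diff power_int_minus divide_simps)
    have "(\<Sum>k\<le>y. qpoch (q powi (- int y)) q k * qpoch (\<delta> * q powi (- int n) * q ^ y) q k * qpoch A q k /
            (qpoch q q k * qpoch (\<alpha> * q) q k * qpoch (\<beta> * \<delta> * q) q k) * q ^ k) =
         qpoch b q y * qpoch c q y * A ^ y / (qpoch (\<alpha> * q) q y * qpoch (\<beta> * \<delta> * q) q y)"
    proof (rule q_Saalschuetz)
      show "A * b = \<beta> * \<delta> * q" "A * c = \<alpha> * q" "A * b * c = \<delta> * q powi (- int n) * q"
        using q_nz \<open>\<alpha> \<noteq> 0\<close> \<open>\<beta> \<noteq> 0\<close> by (simp_all add: A_def b_def c_def power_int_minus field_simps)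
      show "qpoch (\<alpha> * q) q y \<noteq> 0" "qpoch (\<beta> * \<delta> * q) q y \<noteq> 0"
        using \<alpha>[of "Suc _"] \<beta>[of "Suc _"] that by (auto simp: qpoch_eq_0_iff mult.assoc)
    qed
    then have "(\<Sum>k\<le>y. S y k * d k) =
        A ^ y * (qpoch b q y * qpoch c q y / (qpoch (\<alpha> * q) q y * qpoch (\<beta> * \<delta> * q) q y))"
      unfolding e by (simp add: S_def d_def ac_simps)
    \<comment> \<open>Raising the upper limit from \<open>y\<close> to \<open>n\<close> makes the
      range of \<open>k\<close> independent of \<open>y\<close>, so the sums can be
      interchanged.\<close>
    moreover have "S y k = 0" if "y < k" for k
    proof -
      have "q powi (- int y) * q ^ y = 1" using q_nz by (simp add: power_int_minus)
      then show ?thesis using that by (auto simp: S_def qpoch_eq_0_iff)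
    qed
    ultimately show ?thesis
      using \<open>y \<le> n\<close> sum.mono_neutral_right[of "{..n}" "{..y}" "\<lambda>k. S y k * d k"] by auto
  qed
  \<comment> \<open>The prefactor of \<open>qRacah\<close> is the reciprocal of
    \<open>qbinom q N n\<close>, which later cancels the value of the kernel sum.\<close>
  have "qRacah n x \<alpha> \<beta> \<delta> N q = 1 / qbinom q N n *
      (\<Sum>y = x + n - N..min x n. racah_kernel \<delta> N n x y *
        (A ^ y * (qpoch b q y * qpoch c q y / (qpoch (\<alpha> * q) q y * qpoch (\<beta> * \<delta> * q) q y))))"
    unfolding qRacah_def qbinom_def[of q N n] racah_kernel_def A_def b_def c_def
    by (simp add: mult.assoc)
  also have "\<dots> = 1 / qbinom q N n * (\<Sum>y\<le>n. racah_kernel \<delta> N n x y *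
        (A ^ y * (qpoch b q y * qpoch c q y / (qpoch (\<alpha> * q) q y * qpoch (\<beta> * \<delta> * q) q y))))"
  proof -
    have "racah_kernel \<delta> N n x y = 0" if "y \<in> {..n} - {x + n - N..min x n}" for y
      using that \<open>x \<le> N\<close> by (intro racah_kernel_eq_0) auto
    then have "\<forall>y\<in>{..n} - {x + n - N..min x n}. racah_kernel \<delta> N n x y * f y = 0" for f
      by (intro ballI) (simp only: mult_zero_left)
    then show ?thesis
      by (intro arg_cong[of _ _ "\<lambda>s. 1 / qbinom q N n * s"] sum.mono_neutral_left) auto
  qed
  also have "\<dots> = 1 / qbinom q N n * (\<Sum>y\<le>n. \<Sum>k\<le>n. racah_kernel \<delta> N n x y * S y k * d k)"
    by (intro arg_cong[of _ _ "\<lambda>s. 1 / qbinom q N n * s"] sum.cong refl)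
      (simp only: expand atMost_iff, simp only: sum_distrib_left mult.assoc)
  also have "\<dots> = 1 / qbinom q N n * (\<Sum>k\<le>n. (\<Sum>y\<le>n. racah_kernel \<delta> N n x y * S y k) * d k)"
    by (subst sum.swap) (simp add: sum_distrib_right)
  also have "\<dots> = (\<Sum>k\<le>n. qpoch (q powi (- int n)) q k * qpoch (\<delta> * q powi (int x - int N)) q k *
      qpoch (q powi (- int x)) q k / qpoch (q powi (- int N)) q k * d k)"
    unfolding sum_distrib_left S_def
    by (rule sum.cong) (use assms qbinom_nz[of n N] in \<open>simp_all add: sum_racah_kernel_qpoch\<close>)
  also have "\<dots> = qphi43 n (\<delta> * q powi (int x - int N)) (q powi (- int x)) A
      (\<alpha> * q) (\<beta> * \<delta> * q) (q powi (- int N)) q q"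
    unfolding qphi43_def d_def atMost_atLeast0 by (simp add: ac_simps)
  finally show ?thesis by (simp only: A_def)
qed

end

theorem theorem6p5:
  fixes q :: real and n N x :: nat and \<alpha> \<beta> \<delta> :: complex
  assumes "0 < q" and "q < 1"
    and "n \<le> N"
    and "\<alpha> \<noteq> 0" and "\<beta> \<noteq> 0" and "\<delta> \<noteq> 0"
    and "\<And>j::int. \<delta> * of_real q powi j \<noteq> 1"
    and "\<And>j::nat. 1 \<le> j \<Longrightarrow> j \<le> N \<Longrightarrow> \<alpha> * of_real q ^ j \<noteq> 1"
    and "\<And>j::nat. 1 \<le> j \<Longrightarrow> j \<le> N \<Longrightarrow> \<beta> * \<delta> * of_real q ^ j \<noteq> 1"
    and "x \<le> N"
  shows "qRacah n x \<alpha> \<beta> \<delta> N (of_real q) =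
    qphi43 n (\<delta> * of_real q powi (int x - int N)) (of_real q powi (- int x))
      (\<alpha> * \<beta> * of_real q ^ (n + 1))
      (\<alpha> * of_real q) (\<beta> * \<delta> * of_real q) (of_real q powi (- int N))
      (of_real q) (of_real q)"
proof -
  \<comment> \<open>That \<open>q\<close> is not a root of unity is seen from the order on the reals
    and then transferred to the complex numbers.\<close>
  have "q ^ k \<noteq> 1" if "k > 0" for k
    using power_Suc_less_one[of q "k - 1"] assms(1,2) that by simp
  then have "(of_real q :: complex) ^ k \<noteq> 1" if "k > 0" for k
    using that by (metis of_real_eq_1_iff of_real_power)
  then show ?thesis
    using assms by (intro qRacah_eq_qphi43) auto
qed

end
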